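(* If $G$ is a group possessing a subgroup $H$ of index $2$ which is not conjugacy separable, then $G$ has an overgroup $K$, with $|K:G|=3$, such that $K$ is not conjugacy separable.
   Context: An overgroup of $G$ is a group containing $G$ as a subgroup. A group $A$ is conjugacy separable if for any two non-conjugate elements $x,y\in A$ there is a homomorphism $\varphi$ from $A$ to a finite group $M$ such that $\varphi(x)$ and $\varphi(y)$ are not conjugate in $M$. *)

theory Defs
  imports "HOL-Algebra.Coset"
begin

definition conjugate_in :: "('a, 'm) monoid_scheme \<Rightarrow> 'a \<Rightarrow> 'a \<Rightarrow> bool" where
  "conjugate_in A x y \<longleftrightarrow>
     (\<exists>g \<in> carrier A. y = g \<otimes>\<^bsub>A\<^esub> x \<otimes>\<^bsub>A\<^esub> inv\<^bsub>A\<^esub> g)"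

text \<open>
  The finite groups \<open>M\<close> are taken with carrier in \<open>nat\<close>, because a definition cannot
  quantify over types. This loses nothing: every finite group has an isomorphic copy there
  (see \<open>conjugacy_separable_witness\<close> below).
\<close>
definition conjugacy_separable :: "('a, 'm) monoid_scheme \<Rightarrow> bool" where
  "conjugacy_separable A \<longleftrightarrow>
     (\<forall>x \<in> carrier A. \<forall>y \<in> carrier A. \<not> conjugate_in A x y \<longrightarrow>
        (\<exists>(M :: nat monoid) \<phi>. group M \<and> finite (carrier M) \<and> \<phi> \<in> hom A M \<and>
           \<not> conjugate_in M (\<phi> x) (\<phi> y)))"

lemma conjugacy_separable_witness:
  fixes M :: "('b, 'n) monoid_scheme"
  assumes A: "group A" and M: "group M" and fin: "finite (carrier M)"
    and \<phi>: "\<phi> \<in> hom A M" and x: "x \<in> carrier A" and y: "y \<in> carrier A"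
    and nc: "\<not> conjugate_in M (\<phi> x) (\<phi> y)"
  shows "\<exists>(N :: nat monoid) \<psi>. group N \<and> finite (carrier N) \<and> \<psi> \<in> hom A N \<and>
           \<not> conjugate_in N (\<psi> x) (\<psi> y)"
proof -
  interpret M: group M by (rule M)
  obtain e :: "'b \<Rightarrow> nat" where e: "inj_on e (carrier M)"
    using finite_imp_inj_to_nat_seg[OF fin] by blast
  define d where "d = inv_into (carrier M) e"
  have d [simp]: "d (e a) = a" if "a \<in> carrier M" for a
    unfolding d_def using e that by simp
  define N :: "nat monoid" where
    "N = \<lparr>carrier = e ` carrier M, mult = (\<lambda>a b. e (d a \<otimes>\<^bsub>M\<^esub> d b)), one = e \<one>\<^bsub>M\<^esub>\<rparr>"
  have cN: "carrier N = e ` carrier M" by (simp add: N_def)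
  have N: "group N"
  proof (rule groupI)
    fix a assume "a \<in> carrier N"
    then obtain m where m: "m \<in> carrier M" "a = e m" by (auto simp: N_def)
    show "\<exists>b\<in>carrier N. b \<otimes>\<^bsub>N\<^esub> a = \<one>\<^bsub>N\<^esub>"
      by (rule bexI[of _ "e (inv\<^bsub>M\<^esub> m)"]) (use m in \<open>auto simp: N_def\<close>)
  qed (auto simp: N_def M.m_assoc)
  have e_hom: "e \<in> hom M N" by (auto simp: hom_def N_def)
  have \<psi>: "e \<circ> \<phi> \<in> hom A N" using hom_compose[OF \<phi> e_hom] .
  interpret e: group_hom M N e
    by (intro group_hom.intro group_hom_axioms.intro M N e_hom)
  have px: "\<phi> x \<in> carrier M" "\<phi> y \<in> carrier M" using \<phi> x y by (auto simp: hom_def)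
  have "\<not> conjugate_in N (e (\<phi> x)) (e (\<phi> y))"
  proof
    assume "conjugate_in N (e (\<phi> x)) (e (\<phi> y))"
    then obtain g where g: "g \<in> carrier N"
      and eq: "e (\<phi> y) = g \<otimes>\<^bsub>N\<^esub> e (\<phi> x) \<otimes>\<^bsub>N\<^esub> inv\<^bsub>N\<^esub> g"
      unfolding conjugate_in_def by blast
    obtain m where m: "m \<in> carrier M" "g = e m" using g cN by blast
    have "e (m \<otimes>\<^bsub>M\<^esub> \<phi> x \<otimes>\<^bsub>M\<^esub> inv\<^bsub>M\<^esub> m) = e m \<otimes>\<^bsub>N\<^esub> e (\<phi> x) \<otimes>\<^bsub>N\<^esub> inv\<^bsub>N\<^esub> (e m)"
      using m(1) px(1) by (simp only: e.hom_mult e.hom_inv M.m_closed M.inv_closed)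
    then have "e (\<phi> y) = e (m \<otimes>\<^bsub>M\<^esub> \<phi> x \<otimes>\<^bsub>M\<^esub> inv\<^bsub>M\<^esub> m)"
      using eq by (simp only: m(2))
    then have "\<phi> y = m \<otimes>\<^bsub>M\<^esub> \<phi> x \<otimes>\<^bsub>M\<^esub> inv\<^bsub>M\<^esub> m"
      by (rule inj_onD[OF e]) (simp_all only: m(1) px M.m_closed M.inv_closed)
    then show False using nc m(1) unfolding conjugate_in_def by blast
  qed
  then have "\<not> conjugate_in N ((e \<circ> \<phi>) x) ((e \<circ> \<phi>) y)" unfolding comp_apply .
  moreover have "finite (carrier N)" unfolding cN using fin by (rule finite_imageI)
  ultimately show ?thesis using N \<psi> by blast
qed

text \<open>
  \<open>K\<close> is an overgroup of \<open>G\<close>, where \<open>\<iota>\<close> identifies \<open>G\<close> with a subgroup of \<open>K\<close>.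
  Literal inclusion of carriers would be too restrictive: when the carrier of \<open>G\<close> is all of
  its type, no proper overgroup has its carrier in that type.
\<close>
definition overgroup :: "('a, 'm) monoid_scheme \<Rightarrow> ('b, 'n) monoid_scheme \<Rightarrow> ('a \<Rightarrow> 'b) \<Rightarrow> bool"
  where "overgroup G K \<iota> \<longleftrightarrow> group K \<and> \<iota> \<in> mon G K"

text \<open>
  The value is meaningful only for finite index: it is \<open>0\<close> when the index is infinite.
\<close>
definition subgroup_index :: "('a, 'm) monoid_scheme \<Rightarrow> 'a set \<Rightarrow> nat" where
  "subgroup_index A H = card (rcosets\<^bsub>A\<^esub> H)"

end

theory Submission
  imports Defs
begin

text \<open>
  Let \<open>K\<close> be the semidirect product of \<open>G\<close> with the cyclic group \<open>\<langle>c\<rangle>\<close> of order 3, where elements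
  of \<open>H\<close> centralise \<open>c\<close> and elements outside \<open>H\<close> invert it. For \<open>x, y \<in> H\<close>, an element conjugating
  \<open>x c\<close> to \<open>y c\<close> must centralise \<open>c\<close>, so \<open>x c\<close> and \<open>y c\<close> are conjugate in \<open>K\<close> only if \<open>x\<close> and \<open>y\<close> are
  conjugate in \<open>H\<close>. Conversely, if \<open>x\<close> and \<open>y\<close> are conjugate in every finite image of \<open>H\<close>, then for
  each \<open>\<phi>\<close> from \<open>K\<close> to a finite group they are conjugate in \<open>\<phi> H\<close>, which centralises \<open>\<phi> c\<close>, so
  \<open>\<phi> (x c)\<close> and \<open>\<phi> (y c)\<close> are conjugate.
\<close>

text \<open>Clearing the inverse turns conjugacy into an equation between products, so conjugacy
  arguments in the extension never have to compute the inverse of a pair.\<close>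

lemma (in group) conjugate_in_iff:
  assumes "x \<in> carrier G" "y \<in> carrier G"
  shows "conjugate_in G x y \<longleftrightarrow> (\<exists>g\<in>carrier G. y \<otimes> g = g \<otimes> x)"
  unfolding conjugate_in_def
  using assms by (metis inv_solve_right m_closed)

text \<open>The cosets of \<open>g\<close> and of \<open>inv h\<close> both differ from
  \<open>H\<close> itself; as there are only two cosets, they coincide.\<close>

lemma (in group) index_2_mult_mem:
  assumes H: "subgroup H G" and index: "subgroup_index G H = 2"
    and g: "g \<in> carrier G" "g \<notin> H" and h: "h \<in> carrier G" "h \<notin> H"
  shows "g \<otimes> h \<in> H"
proof -
  interpret H: subgroup H G by (rule H)
  obtain A B where AB: "rcosets H = {A, B}"
    using index unfolding subgroup_index_def card_2_iff by blast
  have "H #> \<one> \<in> rcosets H" "H #> g \<in> rcosets H" "H #> inv h \<in> rcosets H"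
    using g h by (auto simp: RCOSETS_def)
  moreover have "H #> g \<noteq> H #> \<one>"
    using rcos_self[OF g(1) H] g H.subset by auto
  moreover have "inv h \<notin> H"
    using h H.m_inv_closed by fastforce
  then have "H #> inv h \<noteq> H #> \<one>"
    using rcos_self[of "inv h" H] h H H.subset by auto
  ultimately have "H #> g = H #> inv h"
    unfolding AB by auto
  then have "g \<in> H #> inv h"
    using rcos_self[OF g(1) H] by simp
  then obtain k where "k \<in> H" "g = k \<otimes> inv h"
    by (auto simp: r_coset_def)
  then show ?thesis
    using h H.subset by (auto simp: m_assoc)
qed

text \<open>Equivalently, \<open>H\<close> is the kernel of a homomorphism to the group of order 2.
  This is what makes the twisted multiplication of the extension associative.\<close>

lemma (in group) index_2_mult_mem_iff:
  assumes H: "subgroup H G" and index: "subgroup_index G H = 2"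
    and g: "g \<in> carrier G" and h: "h \<in> carrier G"
  shows "g \<otimes> h \<in> H \<longleftrightarrow> (g \<in> H \<longleftrightarrow> h \<in> H)"
proof -
  interpret H: subgroup H G by (rule H)
  have "h \<in> H" if "g \<in> H" "g \<otimes> h \<in> H"
  proof -
    have "inv g \<otimes> (g \<otimes> h) \<in> H" using that by blast
    then show ?thesis using g h by (simp add: m_assoc[symmetric])
  qed
  moreover have "g \<in> H" if "h \<in> H" "g \<otimes> h \<in> H"
  proof -
    have "(g \<otimes> h) \<otimes> inv h \<in> H" using that by blast
    then show ?thesis using g h by (simp add: m_assoc)
  qed
  ultimately show ?thesis
    using index_2_mult_mem[OF H index] g h by blast
qed

text \<open>The pair \<open>(g, n)\<close> stands for \<open>g c\<^sup>n\<close>, and \<open>c\<^sup>n h = h c\<^bsup>2n\<^esup>\<close> for \<open>h\<close> outside \<open>H\<close>.\<close>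

definition C3_extension :: "('a, 'm) monoid_scheme \<Rightarrow> 'a set \<Rightarrow> ('a \<times> nat) monoid" where
  "C3_extension G H =
     \<lparr>carrier = carrier G \<times> {..<3},
      mult = (\<lambda>(g, n) (h, m). (g \<otimes>\<^bsub>G\<^esub> h, ((if h \<in> H then n else 2 * n) + m) mod 3)),
      one = (\<one>\<^bsub>G\<^esub>, 0)\<rparr>"

lemma carrier_C3_extension [simp]: "carrier (C3_extension G H) = carrier G \<times> {..<3}"
  by (simp add: C3_extension_def)

lemma mult_C3_extension [simp]:
  "(g, n) \<otimes>\<^bsub>C3_extension G H\<^esub> (h, m) =
     (g \<otimes>\<^bsub>G\<^esub> h, ((if h \<in> H then n else 2 * n) + m) mod 3)"
  by (simp add: C3_extension_def)

lemma one_C3_extension [simp]: "\<one>\<^bsub>C3_extension G H\<^esub> = (\<one>\<^bsub>G\<^esub>, 0)"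
  by (simp add: C3_extension_def)

lemma (in group) group_C3_extension:
  assumes H: "subgroup H G" and index: "subgroup_index G H = 2"
  shows "group (C3_extension G H)"
proof (rule groupI)
  interpret H: subgroup H G by (rule H)
  fix a b c
  assume "a \<in> carrier (C3_extension G H)" "b \<in> carrier (C3_extension G H)"
    "c \<in> carrier (C3_extension G H)"
  then obtain g n h m k l where
    abc: "a = (g, n)" "b = (h, m)" "c = (k, l)"
      and gr: "g \<in> carrier G" "h \<in> carrier G" "k \<in> carrier G"
    by auto
  \<comment> \<open>Needed when \<open>h\<close> and \<open>k\<close> both lie outside
    \<open>H\<close>: one bracketing doubles \<open>n\<close> twice, the other leaves it alone
    because \<open>h \<otimes> k\<close> is in \<open>H\<close>.\<close>
  have four: "(4 * n + j) mod 3 = (n + j) mod 3" for j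
    using mod_mult_self2[of "n + j" 3 n] by (simp add: algebra_simps)
  have double: "(2 * (i mod 3) + j) mod 3 = (2 * i + j) mod 3" for i j :: nat
    by (metis mod_add_left_eq mod_mult_right_eq)
  show "a \<otimes>\<^bsub>C3_extension G H\<^esub> b \<otimes>\<^bsub>C3_extension G H\<^esub> c =
    a \<otimes>\<^bsub>C3_extension G H\<^esub> (b \<otimes>\<^bsub>C3_extension G H\<^esub> c)"
    using gr four double
    by (simp add: abc m_assoc index_2_mult_mem_iff[OF H index] mod_simps distrib_left add.assoc)
next
  interpret H: subgroup H G by (rule H)
  fix a assume "a \<in> carrier (C3_extension G H)"
  then obtain g n where a: "a = (g, n)" "g \<in> carrier G" "n < 3" by auto
  \<comment> \<open>The inverse of \<open>g c^n\<close> is \<open>c^(-n)\<close> times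
    \<open>inv g\<close>. Moving \<open>inv g\<close> to the front leaves exponent
    \<open>-n\<close>, that is \<open>2 * n\<close> modulo 3, if \<open>g\<close> is in
    \<open>H\<close>, and \<open>n\<close> otherwise.\<close>
  define b where "b = (inv g, (if g \<in> H then 2 * n else n) mod 3)"
  have "b \<in> carrier (C3_extension G H)" using a by (auto simp: b_def)
  moreover have "b \<otimes>\<^bsub>C3_extension G H\<^esub> a = \<one>\<^bsub>C3_extension G H\<^esub>"
    using a by (auto simp: b_def mod_simps)
  ultimately show "\<exists>b\<in>carrier (C3_extension G H). b \<otimes>\<^bsub>C3_extension G H\<^esub> a = \<one>\<^bsub>C3_extension G H\<^esub>"
    by blast
qed (use subgroup.one_closed[OF H] in auto)

lemma (in group) mon_C3_extension: "(\<lambda>g. (g, 0)) \<in> mon G (C3_extension G H)"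
  by (auto simp: mon_def hom_def inj_on_def)

lemma (in group) index_C3_extension:
  "subgroup_index (C3_extension G H) ((\<lambda>g. (g, 0)) ` carrier G) = 3"
proof -
  let ?\<iota> = "\<lambda>g. (g, 0 :: nat)"
  \<comment> \<open>Multiplying by \<open>(h', 0)\<close> on the left keeps the exponent, since
    doubling 0 gives 0; so there is one coset for each exponent.\<close>
  have coset: "?\<iota> ` carrier G #>\<^bsub>C3_extension G H\<^esub> (g, n) = carrier G \<times> {n}"
    if "g \<in> carrier G" "n < 3" for g n
  proof -
    have "\<exists>h'\<in>carrier G. h = h' \<otimes> g" if "h \<in> carrier G" for h
      using that \<open>g \<in> carrier G\<close> by (intro bexI[of _ "h \<otimes> inv g"]) (auto simp: m_assoc)
    then show ?thesis
      using that by (auto simp: r_coset_def)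
  qed
  have "rcosets\<^bsub>C3_extension G H\<^esub> (?\<iota> ` carrier G) = (\<lambda>n. carrier G \<times> {n}) ` {..<3}"
  proof -
    have "rcosets\<^bsub>C3_extension G H\<^esub> (?\<iota> ` carrier G) =
        (\<lambda>a. ?\<iota> ` carrier G #>\<^bsub>C3_extension G H\<^esub> a) ` (carrier G \<times> {..<3})"
      by (auto simp: RCOSETS_def)
    also have "\<dots> = (\<lambda>a. carrier G \<times> {snd a}) ` (carrier G \<times> {..<3})"
      by (rule image_cong) (auto simp: coset)
    also have "\<dots> = (\<lambda>n. carrier G \<times> {n}) ` snd ` (carrier G \<times> {..<3})"
      by (simp only: image_image)
    also have "snd ` (carrier G \<times> {..<3 :: nat}) = {..<3}"
      using one_closed by force
    finally show ?thesis .
  qed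
  moreover have "inj_on (\<lambda>n. carrier G \<times> {n}) {..<3 :: nat}"
    using one_closed by (auto simp: inj_on_def)
  ultimately show ?thesis
    by (simp add: subgroup_index_def card_image)
qed

lemma (in group) conjugate_in_C3_extensionD:
  assumes H: "subgroup H G" and index: "subgroup_index G H = 2"
    and x: "x \<in> H" and y: "y \<in> H"
    and conj: "conjugate_in (C3_extension G H) (x, 1) (y, 1)"
  shows "conjugate_in (G\<lparr>carrier := H\<rparr>) x y"
proof -
  interpret H: subgroup H G by (rule H)
  interpret GH: group "G\<lparr>carrier := H\<rparr>" by (rule H.subgroup_is_group) (rule group_axioms)
  interpret K: group "C3_extension G H" by (rule group_C3_extension[OF H index])
  obtain g n where g: "g \<in> carrier G" "n < 3"
    and eq: "(y, 1) \<otimes>\<^bsub>C3_extension G H\<^esub> (g, n) = (g, n) \<otimes>\<^bsub>C3_extension G H\<^esub> (x, 1)"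
    using conj x y by (subst (asm) K.conjugate_in_iff) auto
  have "g \<in> H"
  proof (rule ccontr)
    assume "g \<notin> H"
    \<comment> \<open>Exponents of the two sides of \<open>eq\<close>: on the left \<open>g\<close>
      doubles the 1, on the right \<open>x\<close> in \<open>H\<close> leaves \<open>n\<close>
      unchanged.\<close>
    then have "(2 + n) mod 3 = (n + 1) mod 3" using eq x by simp
    then show False by presburger
  qed
  then show ?thesis
    using eq x y by (subst GH.conjugate_in_iff) auto
qed

lemma (in group) hom_C3_extension_restrict:
  assumes H: "subgroup H G" and \<phi>: "\<phi> \<in> hom (C3_extension G H) M"
  shows "(\<lambda>h. \<phi> (h, 0)) \<in> hom (G\<lparr>carrier := H\<rparr>) M"
proof (rule homI)
  interpret H: subgroup H G by (rule H)
  fix g h assume gh: "g \<in> carrier (G\<lparr>carrier := H\<rparr>)" "h \<in> carrier (G\<lparr>carrier := H\<rparr>)"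
  show "\<phi> (g, 0) \<in> carrier M"
    using hom_in_carrier[OF \<phi>, of "(g, 0)"] gh by simp
  show "\<phi> (g \<otimes>\<^bsub>G\<lparr>carrier := H\<rparr>\<^esub> h, 0) = \<phi> (g, 0) \<otimes>\<^bsub>M\<^esub> \<phi> (h, 0)"
    using hom_mult[OF \<phi>, of "(g, 0)" "(h, 0)"] gh by simp
qed

lemma (in group) conjugate_in_hom_C3_extension:
  assumes H: "subgroup H G" and index: "subgroup_index G H = 2"
    and M: "group M" and \<phi>: "\<phi> \<in> hom (C3_extension G H) M"
    and x: "x \<in> H" and y: "y \<in> H"
    and conj: "conjugate_in (M\<lparr>carrier := (\<lambda>h. \<phi> (h, 0)) ` H\<rparr>) (\<phi> (x, 0)) (\<phi> (y, 0))"
  shows "conjugate_in M (\<phi> (x, 1)) (\<phi> (y, 1))"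
proof -
  interpret H: subgroup H G by (rule H)
  interpret GH: group "G\<lparr>carrier := H\<rparr>" by (rule H.subgroup_is_group) (rule group_axioms)
  interpret K: group "C3_extension G H" by (rule group_C3_extension[OF H index])
  interpret M: group M by (rule M)
  interpret \<phi>: group_hom "C3_extension G H" M \<phi>
    by (intro group_hom.intro group_hom_axioms.intro K.group_axioms M \<phi>)
  have "(\<lambda>h. \<phi> (h, 0)) \<in> hom (G\<lparr>carrier := H\<rparr>) M"
    by (rule hom_C3_extension_restrict[OF H \<phi>])
  then interpret \<psi>: group_hom "G\<lparr>carrier := H\<rparr>" M "\<lambda>h. \<phi> (h, 0)"
    by (intro group_hom.intro group_hom_axioms.intro GH.group_axioms M)
  interpret N: group "M\<lparr>carrier := (\<lambda>h. \<phi> (h, 0)) ` H\<rparr>"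
    using \<psi>.img_is_subgroup M by (simp add: subgroup.subgroup_is_group)
  obtain h where h: "h \<in> H" and eq: "\<phi> (y, 0) \<otimes>\<^bsub>M\<^esub> \<phi> (h, 0) = \<phi> (h, 0) \<otimes>\<^bsub>M\<^esub> \<phi> (x, 0)"
    using conj x y by (subst (asm) N.conjugate_in_iff) auto
  have split: "\<phi> (k, 1) = \<phi> (k, 0) \<otimes>\<^bsub>M\<^esub> \<phi> (\<one>, 1)" if "k \<in> H" for k
    using \<phi>.hom_mult[of "(k, 0)" "(\<one>, 1)"] that by simp
  \<comment> \<open>Here it matters that the conjugator is the image of some \<open>h\<close> in
    \<open>H\<close>: such an \<open>h\<close> passes \<open>c\<close> without changing its
    exponent.\<close>
  have "\<phi> (y, 1) \<otimes>\<^bsub>M\<^esub> \<phi> (h, 0) = \<phi> (y \<otimes> h, 1)"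
    using \<phi>.hom_mult[of "(y, 1)" "(h, 0)"] y h by simp
  also have "\<dots> = \<phi> (y, 0) \<otimes>\<^bsub>M\<^esub> \<phi> (h, 0) \<otimes>\<^bsub>M\<^esub> \<phi> (\<one>, 1)"
    using \<psi>.hom_mult[of y h] y h by (subst split) auto
  also have "\<dots> = \<phi> (h, 0) \<otimes>\<^bsub>M\<^esub> \<phi> (x, 1)"
    using x h by (simp add: eq split[OF x, simplified] M.m_assoc)
  finally show ?thesis
    using x y h by (subst M.conjugate_in_iff) (auto intro!: bexI[of _ "\<phi> (h, 0)"])
qed

theorem corollary6p3:
  fixes G :: "('a, 'm) monoid_scheme" and H :: "'a set"
  assumes "group G"
    and "subgroup H G"
    and "subgroup_index G H = 2"
    and "\<not> conjugacy_separable (G\<lparr>carrier := H\<rparr>)"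
  shows "\<exists>(K :: ('a \<times> nat) monoid) \<iota>.
           overgroup G K \<iota> \<and> subgroup_index K (\<iota> ` carrier G) = 3 \<and>
           \<not> conjugacy_separable K"
proof -
  interpret group G by (rule assms(1))
  interpret H: subgroup H G by (rule assms(2))
  interpret GH: group "G\<lparr>carrier := H\<rparr>" by (rule H.subgroup_is_group) (rule group_axioms)
  let ?K = "C3_extension G H"
  interpret K: group ?K by (rule group_C3_extension[OF assms(2,3)])
  obtain x y where xy: "x \<in> H" "y \<in> H" and nc: "\<not> conjugate_in (G\<lparr>carrier := H\<rparr>) x y"
    and insep: "\<And>(M :: nat monoid) \<psi>. group M \<Longrightarrow> finite (carrier M) \<Longrightarrow>
      \<psi> \<in> hom (G\<lparr>carrier := H\<rparr>) M \<Longrightarrow> conjugate_in M (\<psi> x) (\<psi> y)"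
    using assms(4) unfolding conjugacy_separable_def by auto
  have "\<not> conjugacy_separable ?K"
  proof
    assume "conjugacy_separable ?K"
    moreover have "(x, 1) \<in> carrier ?K" "(y, 1) \<in> carrier ?K" using xy by auto
    moreover have "\<not> conjugate_in ?K (x, 1) (y, 1)"
      using conjugate_in_C3_extensionD[OF assms(2,3) xy] nc by blast
    ultimately obtain M :: "nat monoid" and \<phi> where
      M: "group M" "finite (carrier M)" and \<phi>: "\<phi> \<in> hom ?K M"
      and sep: "\<not> conjugate_in M (\<phi> (x, 1)) (\<phi> (y, 1))"
      unfolding conjugacy_separable_def by blast
    let ?\<psi> = "\<lambda>h. \<phi> (h, 0)"
    have \<psi>: "?\<psi> \<in> hom (G\<lparr>carrier := H\<rparr>) M"
      by (rule hom_C3_extension_restrict[OF assms(2) \<phi>])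
    then interpret \<psi>: group_hom "G\<lparr>carrier := H\<rparr>" M ?\<psi>
      by (intro group_hom.intro group_hom_axioms.intro GH.group_axioms M(1))
    \<comment> \<open>Inseparability is applied to the image of \<open>H\<close>, not to
      \<open>M\<close>: a conjugator found in \<open>M\<close> need not commute with the image of
      \<open>c\<close>. The carrier still lies in \<open>nat\<close>, as \<open>insep\<close>
      demands.\<close>
    let ?N = "M\<lparr>carrier := ?\<psi> ` H\<rparr>"
    have "group ?N"
      using \<psi>.img_is_subgroup M(1) by (simp add: subgroup.subgroup_is_group)
    moreover have "finite (carrier ?N)"
      by (rule finite_subset[OF _ M(2)]) (use \<psi>.hom_closed in auto)
    moreover have "?\<psi> \<in> hom (G\<lparr>carrier := H\<rparr>) ?N"
      using \<psi> by (auto simp: hom_def)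
    ultimately have "conjugate_in ?N (\<phi> (x, 0)) (\<phi> (y, 0))" by (rule insep)
    then show False
      using conjugate_in_hom_C3_extension[OF assms(2,3) M(1) \<phi> xy] sep by blast
  qed
  then show ?thesis
    using K.group_axioms mon_C3_extension index_C3_extension unfolding overgroup_def by blast
qed

end
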